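(* Let $p\ge 1$, let $J=\{1,\dots,p\}$, and let $(\Omega_j,\mathcal{A}_j,P_j)$, $j\in J$, be probability spaces with product $(\Omega,\mathcal{A},P)=\left(\prod_{j=1}^p\Omega_j,\bigotimes_{j=1}^p\mathcal{A}_j,\prod_{j=1}^pP_j\right)$. Every finite signed measure $\mu$ on $(\Omega,\mathcal{A})$ can be written as $$\mu\left(\prod_{j=1}^pA_j\right)=\sum_{H\subset J}P_{J\setminus H}\left(\prod_{j\in J\setminus H}A_j\right)\,\mu_H\left(\prod_{j\in H}A_j\right)\qquad\text{for all }A_j\in\mathcal{A}_j,\ j\in J,$$ where, for each $H\subset J$, $\mu_H$ is a finite signed zm-measure on $\Omega_H$. This decomposition is unique (that is, the family $(\mu_H)_{H\subset J}$ of zm-measures is uniquely determined by $\mu$), and the map $\mu\mapsto(\mu_H)_{H\subset J}$ is linear and continuous in the supremum norm.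
   Context: For $H\subset J$ (the empty set and $J$ itself included), $\Omega_H=\prod_{j\in H}\Omega_j$ is equipped with the product $\sigma$-algebra $\bigotimes_{j\in H}\mathcal{A}_j$, and $P_H=\prod_{j\in H}P_j$ is the product probability measure on it. A finite signed measure $M_H$ on $\Omega_H$ is called a zm-measure (zero-marginals measure) when all its marginals vanish, that is, $M_H\left(\prod_{j\in H}A_j\right)=0$ whenever $A_j\in\mathcal{A}_j$ for all $j\in H$ and $A_j=\Omega_j$ for at least one $j\in H$. Convention for $H=\emptyset$: $\Omega_\emptyset$ is a one-point space, the empty product of sets is $\Omega_\emptyset$, $P_\emptyset(\Omega_\emptyset)=1$, every finite signed measure on $\Omega_\emptyset$ is vacuously a zm-measure, and such a measure is identified with a real constant. The supremum norm of a finite signed measure $M$ on a measurable space is $\sup_A|M(A)|$, the supremum being over all measurable sets $A$; a finite family $(\mu_H)_{H\subset J}$ is given the maximum of the supremum norms of its members. *)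

theory Defs
  imports "HOL-Probability.Probability"
begin

text \<open>
  A signed measure on \<open>M\<close> is represented by its set function, extended by \<open>0\<close> to the
  non-measurable sets, so that two signed measures agree on all measurable sets iff they are equal.
\<close>

definition finite_signed_measures :: "'a measure \<Rightarrow> ('a set \<Rightarrow> real) set" where
  "finite_signed_measures M = {\<mu>.
     \<mu> {} = 0 \<and>
     (\<forall>A. range A \<subseteq> sets M \<longrightarrow> disjoint_family A \<longrightarrow>
        (\<lambda>i::nat. \<mu> (A i)) sums \<mu> (\<Union>i. A i)) \<and>
     (\<forall>A. A \<notin> sets M \<longrightarrow> \<mu> A = 0)}"

definition sup_norm :: "'a measure \<Rightarrow> ('a set \<Rightarrow> real) \<Rightarrow> real" where
  "sup_norm M \<mu> = (SUP A\<in>sets M. \<bar>\<mu> A\<bar>)"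

text \<open>
  The locale \<open>Metric_space\<close> requires nonnegativity and symmetry of the distance also outside the
  carrier, hence the value \<open>0\<close> there (also in \<open>family_dist\<close> below).
\<close>

definition sup_dist :: "'a measure \<Rightarrow> ('a set \<Rightarrow> real) \<Rightarrow> ('a set \<Rightarrow> real) \<Rightarrow> real" where
  "sup_dist M \<mu> \<nu> =
     (if \<mu> \<in> finite_signed_measures M \<and> \<nu> \<in> finite_signed_measures M
      then sup_norm M (\<lambda>A. \<mu> A - \<nu> A) else 0)"

text \<open>
  For \<open>H = {}\<close> the space of \<open>Pi\<^sub>M H P\<close> is \<open>{\<lambda>_. undefined}\<close> and the vanishing condition is vacuous.
\<close>

definition zm_measures :: "('i \<Rightarrow> 'a measure) \<Rightarrow> 'i set \<Rightarrow> (('i \<Rightarrow> 'a) set \<Rightarrow> real) set" where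
  "zm_measures P H = {\<nu> \<in> finite_signed_measures (Pi\<^sub>M H P).
     \<forall>A. (\<forall>j\<in>H. A j \<in> sets (P j)) \<longrightarrow> (\<exists>j\<in>H. A j = space (P j)) \<longrightarrow> \<nu> (Pi\<^sub>E H A) = 0}"

definition zm_families ::
    "('i \<Rightarrow> 'a measure) \<Rightarrow> 'i set \<Rightarrow> ('i set \<Rightarrow> ('i \<Rightarrow> 'a) set \<Rightarrow> real) set" where
  "zm_families P J = (\<Pi>\<^sub>E H\<in>Pow J. zm_measures P H)"

definition family_norm ::
    "('i \<Rightarrow> 'a measure) \<Rightarrow> 'i set \<Rightarrow> ('i set \<Rightarrow> ('i \<Rightarrow> 'a) set \<Rightarrow> real) \<Rightarrow> real" where
  "family_norm P J \<nu> = Max ((\<lambda>H. sup_norm (Pi\<^sub>M H P) (\<nu> H)) ` Pow J)"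

definition family_dist ::
    "('i \<Rightarrow> 'a measure) \<Rightarrow> 'i set \<Rightarrow> ('i set \<Rightarrow> ('i \<Rightarrow> 'a) set \<Rightarrow> real) \<Rightarrow>
     ('i set \<Rightarrow> ('i \<Rightarrow> 'a) set \<Rightarrow> real) \<Rightarrow> real" where
  "family_dist P J \<nu> \<nu>' =
     (if \<nu> \<in> zm_families P J \<and> \<nu>' \<in> zm_families P J
      then family_norm P J (\<lambda>H A. \<nu> H A - \<nu>' H A) else 0)"

definition is_zm_decomposition ::
    "('i \<Rightarrow> 'a measure) \<Rightarrow> 'i set \<Rightarrow> (('i \<Rightarrow> 'a) set \<Rightarrow> real) \<Rightarrow>
     ('i set \<Rightarrow> ('i \<Rightarrow> 'a) set \<Rightarrow> real) \<Rightarrow> bool" where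
  "is_zm_decomposition P J \<mu> \<nu> \<longleftrightarrow>
     \<nu> \<in> zm_families P J \<and>
     (\<forall>A. (\<forall>j\<in>J. A j \<in> sets (P j)) \<longrightarrow>
        \<mu> (Pi\<^sub>E J A) =
        (\<Sum>H\<in>Pow J. measure (Pi\<^sub>M (J - H) P) (Pi\<^sub>E (J - H) A) * \<nu> H (Pi\<^sub>E H A)))"

definition zm_decomposition ::
    "('i \<Rightarrow> 'a measure) \<Rightarrow> 'i set \<Rightarrow> (('i \<Rightarrow> 'a) set \<Rightarrow> real) \<Rightarrow>
     'i set \<Rightarrow> ('i \<Rightarrow> 'a) set \<Rightarrow> real" where
  "zm_decomposition P J \<mu> = (THE \<nu>. is_zm_decomposition P J \<mu> \<nu>)"

definition signed_measure_topology :: "'a measure \<Rightarrow> ('a set \<Rightarrow> real) topology" where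
  "signed_measure_topology M = Metric_space.mtopology (finite_signed_measures M) (sup_dist M)"

definition zm_family_topology ::
    "('i \<Rightarrow> 'a measure) \<Rightarrow> 'i set \<Rightarrow> ('i set \<Rightarrow> ('i \<Rightarrow> 'a) set \<Rightarrow> real) topology" where
  "zm_family_topology P J = Metric_space.mtopology (zm_families P J) (family_dist P J)"


text \<open>
  The suprema above are finite and the distances are metrics; since \<open>Metric_space.mtopology\<close> and
  the real-valued supremum are total functions, this is not enforced by the definitions.
\<close>

lemma finite_signed_measure_Un:
  assumes \<mu>: "\<mu> \<in> finite_signed_measures M" and "A \<in> sets M" "B \<in> sets M" "A \<inter> B = {}"
  shows "\<mu> (A \<union> B) = \<mu> A + \<mu> B"
proof -
  have z: "\<mu> {} = 0" using \<mu> by (simp add: finite_signed_measures_def)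
  have "range (binaryset A B) \<subseteq> sets M"
    using assms by (auto simp: range_binaryset_eq)
  moreover have "disjoint_family (binaryset A B)"
    using assms by (auto simp: disjoint_family_on_def binaryset_def)
  ultimately have "(\<lambda>i. \<mu> (binaryset A B i)) sums \<mu> (\<Union>i. binaryset A B i)"
    using \<mu> by (simp add: finite_signed_measures_def)
  moreover have "(\<lambda>i. \<mu> (binaryset A B i)) sums (\<mu> A + \<mu> B)"
    using binaryset_sums[of \<mu>] z by simp
  ultimately show ?thesis
    by (metis UN_binaryset_eq sums_unique2)
qed

lemma finite_signed_measure_bounded:
  assumes \<mu>: "\<mu> \<in> finite_signed_measures M"
  shows "\<exists>C. \<forall>A\<in>sets M. \<bar>\<mu> A\<bar> \<le> C"
proof (rule ccontr)
  assume unb: "\<not> ?thesis"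
  define big where
    "big X \<longleftrightarrow> X \<in> sets M \<and> (\<forall>C. \<exists>B\<in>sets M. B \<subseteq> X \<and> C < \<bar>\<mu> B\<bar>)" for X
  note Un = finite_signed_measure_Un[OF \<mu>]
  have step: "\<exists>Y. big Y \<and> Y \<subseteq> X \<and> 1 \<le> \<bar>\<mu> (X - Y)\<bar>" if X: "big X" for X
  proof -
    obtain E where E: "E \<in> sets M" "E \<subseteq> X" "\<bar>\<mu> X\<bar> + 1 < \<bar>\<mu> E\<bar>"
      using X unfolding big_def by blast
    have Xs: "X \<in> sets M" using X by (simp add: big_def)
    have "\<mu> X = \<mu> E + \<mu> (X - E)"
      using Un[of E "X - E"] E Xs by (simp add: Un_absorb1)
    then have D: "1 \<le> \<bar>\<mu> (X - E)\<bar>" "1 \<le> \<bar>\<mu> E\<bar>" using E(3) by linarith+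
    have "big E \<or> big (X - E)"
    proof (rule ccontr)
      assume "\<not> ?thesis"
      then obtain C C' where
        C: "\<And>B. B \<in> sets M \<Longrightarrow> B \<subseteq> E \<Longrightarrow> \<bar>\<mu> B\<bar> \<le> C" and
        C': "\<And>B. B \<in> sets M \<Longrightarrow> B \<subseteq> X - E \<Longrightarrow> \<bar>\<mu> B\<bar> \<le> C'"
        using E(1) Xs unfolding big_def by (metis not_le sets.Diff)
      obtain B where B: "B \<in> sets M" "B \<subseteq> X" "C + C' < \<bar>\<mu> B\<bar>"
        using X unfolding big_def by blast
      have "\<mu> B = \<mu> (B \<inter> E) + \<mu> (B - E)"
        using Un[of "B \<inter> E" "B - E"] B E by (simp add: Int_Diff_Un Int_Diff_disjoint)
      moreover have "\<bar>\<mu> (B \<inter> E)\<bar> \<le> C" using B E by (intro C) auto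
      moreover have "\<bar>\<mu> (B - E)\<bar> \<le> C'" using B E by (intro C') auto
      ultimately show False using B(3) by linarith
    qed
    then show ?thesis
    proof
      assume "big E" then show ?thesis using E D by blast
    next
      assume "big (X - E)" then show ?thesis
        using E D by (intro exI[of _ "X - E"]) (auto simp: double_diff)
    qed
  qed
  have "big (space M)"
    using unb sets.sets_into_space unfolding big_def by (metis not_le sets.top)
  then obtain X where X: "\<And>n::nat. big (X n)" "\<And>n. X (Suc n) \<subseteq> X n"
      "\<And>n. 1 \<le> \<bar>\<mu> (X n - X (Suc n))\<bar>"
    using dependent_nat_choice[of "\<lambda>_. big" "\<lambda>_ X Y. Y \<subseteq> X \<and> 1 \<le> \<bar>\<mu> (X - Y)\<bar>"] step by metis
  have dec: "X n \<subseteq> X m" if "m \<le> n" for m n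
    using X(2) that by (rule lift_Suc_antimono_le)
  have "disjoint_family (\<lambda>n. X n - X (Suc n))"
    unfolding disjoint_family_on_def
  proof (intro ballI impI)
    fix m n :: nat assume "m \<noteq> n"
    then consider "Suc m \<le> n" | "Suc n \<le> m" by linarith
    then show "(X m - X (Suc m)) \<inter> (X n - X (Suc n)) = {}"
      using dec by cases blast+
  qed
  moreover have "range (\<lambda>n. X n - X (Suc n)) \<subseteq> sets M"
    using X(1) by (auto simp: big_def)
  ultimately have "summable (\<lambda>n. \<mu> (X n - X (Suc n)))"
    using \<mu> unfolding finite_signed_measures_def by (blast intro: sums_summable)
  then have "(\<lambda>n. \<mu> (X n - X (Suc n))) \<longlonglongrightarrow> 0"
    by (rule summable_LIMSEQ_zero)
  then obtain n where "norm (\<mu> (X n - X (Suc n)) - 0) < 1"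
    using LIMSEQ_D[of _ 0 1] by fastforce
  then show False using X(3)[of n] by simp
qed

lemma bdd_above_signed_measure_diff:
  assumes "\<mu> \<in> finite_signed_measures M" "\<nu> \<in> finite_signed_measures M"
  shows "bdd_above ((\<lambda>A. \<bar>\<mu> A - \<nu> A\<bar>) ` sets M)"
proof -
  obtain C D where "\<And>A. A \<in> sets M \<Longrightarrow> \<bar>\<mu> A\<bar> \<le> C" "\<And>A. A \<in> sets M \<Longrightarrow> \<bar>\<nu> A\<bar> \<le> D"
    using finite_signed_measure_bounded[OF assms(1)] finite_signed_measure_bounded[OF assms(2)]
    by blast
  then show ?thesis
    by (intro bdd_aboveI2[of _ _ "C + D"]) (smt (verit, best))
qed

lemma sup_dist_upper:
  assumes "\<mu> \<in> finite_signed_measures M" "\<nu> \<in> finite_signed_measures M" "A \<in> sets M"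
  shows "\<bar>\<mu> A - \<nu> A\<bar> \<le> sup_dist M \<mu> \<nu>"
  using cSUP_upper[OF assms(3) bdd_above_signed_measure_diff[OF assms(1,2)]] assms
  by (simp add: sup_dist_def sup_norm_def)

lemma sup_dist_least:
  assumes "\<mu> \<in> finite_signed_measures M" "\<nu> \<in> finite_signed_measures M"
    and "\<And>A. A \<in> sets M \<Longrightarrow> \<bar>\<mu> A - \<nu> A\<bar> \<le> C"
  shows "sup_dist M \<mu> \<nu> \<le> C"
proof -
  have "sup_norm M (\<lambda>A. \<mu> A - \<nu> A) \<le> C"
    unfolding sup_norm_def by (rule cSUP_least) (use assms sets.top in blast)+
  then show ?thesis using assms by (simp add: sup_dist_def)
qed

lemma Metric_space_sup_dist: "Metric_space (finite_signed_measures M) (sup_dist M)"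
proof
  fix \<mu> \<nu>
  show nonneg: "0 \<le> sup_dist M \<mu> \<nu>"
    using sup_dist_upper[of \<mu> M \<nu> "{}"]
    by (cases "\<mu> \<in> finite_signed_measures M \<and> \<nu> \<in> finite_signed_measures M")
       (force, auto simp: sup_dist_def)
  show "sup_dist M \<mu> \<nu> = sup_dist M \<nu> \<mu>"
    by (auto simp: sup_dist_def sup_norm_def abs_minus_commute)
  assume S: "\<mu> \<in> finite_signed_measures M" "\<nu> \<in> finite_signed_measures M"
  show "sup_dist M \<mu> \<nu> = 0 \<longleftrightarrow> \<mu> = \<nu>"
  proof
    assume 0: "sup_dist M \<mu> \<nu> = 0"
    show "\<mu> = \<nu>"
    proof
      fix A show "\<mu> A = \<nu> A"
        using sup_dist_upper[OF S, of A] 0 S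
        by (cases "A \<in> sets M") (auto simp: finite_signed_measures_def)
    qed
  next
    assume "\<mu> = \<nu>"
    then show "sup_dist M \<mu> \<nu> = 0"
      using sup_dist_least[OF S, of 0] nonneg by simp
  qed
next
  fix \<mu> \<nu> \<kappa>
  assume S: "\<mu> \<in> finite_signed_measures M" "\<nu> \<in> finite_signed_measures M"
    "\<kappa> \<in> finite_signed_measures M"
  show "sup_dist M \<mu> \<kappa> \<le> sup_dist M \<mu> \<nu> + sup_dist M \<nu> \<kappa>"
  proof (rule sup_dist_least[OF S(1,3)])
    fix A assume "A \<in> sets M"
    then show "\<bar>\<mu> A - \<kappa> A\<bar> \<le> sup_dist M \<mu> \<nu> + sup_dist M \<nu> \<kappa>"
      using sup_dist_upper[OF S(1,2)] sup_dist_upper[OF S(2,3)] by (smt (verit, best))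
  qed
qed

lemma zm_familiesD:
  "\<nu> \<in> zm_families P J \<Longrightarrow> H \<subseteq> J \<Longrightarrow> \<nu> H \<in> finite_signed_measures (Pi\<^sub>M H P)"
  by (auto simp: zm_families_def zm_measures_def PiE_iff)

lemma family_dist_eq:
  assumes "\<nu> \<in> zm_families P J" "\<nu>' \<in> zm_families P J"
  shows "family_dist P J \<nu> \<nu>' = Max ((\<lambda>H. sup_dist (Pi\<^sub>M H P) (\<nu> H) (\<nu>' H)) ` Pow J)"
  using assms by (auto simp: family_dist_def family_norm_def sup_dist_def zm_familiesD
      intro!: arg_cong[where f = Max] image_cong)

lemma Metric_space_family_dist:
  assumes "finite J"
  shows "Metric_space (zm_families P J) (family_dist P J)"
proof -
  have S: "Metric_space (finite_signed_measures (Pi\<^sub>M H P)) (sup_dist (Pi\<^sub>M H P))" for H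
    by (rule Metric_space_sup_dist)
  have upper: "sup_dist (Pi\<^sub>M H P) (\<nu> H) (\<nu>' H) \<le> family_dist P J \<nu> \<nu>'"
    if "\<nu> \<in> zm_families P J" "\<nu>' \<in> zm_families P J" "H \<subseteq> J" for H \<nu> \<nu>'
    unfolding family_dist_eq[OF that(1,2)] using assms that by (intro Max_ge) auto
  have least: "family_dist P J \<nu> \<nu>' \<le> C"
    if "\<nu> \<in> zm_families P J" "\<nu>' \<in> zm_families P J"
      "\<And>H. H \<subseteq> J \<Longrightarrow> sup_dist (Pi\<^sub>M H P) (\<nu> H) (\<nu>' H) \<le> C" for \<nu> \<nu>' C
    unfolding family_dist_eq[OF that(1,2)] using assms that by (intro Max.boundedI) auto
  show ?thesis
  proof
    fix \<nu> \<nu>'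
    show nonneg: "0 \<le> family_dist P J \<nu> \<nu>'"
      using upper[of \<nu> \<nu>' "{}"] Metric_space.nonneg[OF S, of "{}" "\<nu> {}" "\<nu>' {}"]
      by (cases "\<nu> \<in> zm_families P J \<and> \<nu>' \<in> zm_families P J")
         (force, auto simp: family_dist_def)
    show "family_dist P J \<nu> \<nu>' = family_dist P J \<nu>' \<nu>"
      by (auto simp: family_dist_def family_norm_def sup_norm_def abs_minus_commute)
    assume F: "\<nu> \<in> zm_families P J" "\<nu>' \<in> zm_families P J"
    show "family_dist P J \<nu> \<nu>' = 0 \<longleftrightarrow> \<nu> = \<nu>'"
    proof
      assume 0: "family_dist P J \<nu> \<nu>' = 0"
      have "\<nu> H = \<nu>' H" if "H \<in> Pow J" for H
      proof -
        have "sup_dist (Pi\<^sub>M H P) (\<nu> H) (\<nu>' H) = 0"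
          using upper[OF F, of H] 0 that Metric_space.nonneg[OF S, of H "\<nu> H" "\<nu>' H"]
          by auto
        then show ?thesis
          using Metric_space.zero[OF S] zm_familiesD[OF F(1)] zm_familiesD[OF F(2)] that by blast
      qed
      then show "\<nu> = \<nu>'"
        using F unfolding zm_families_def by (intro PiE_ext) auto
    next
      assume "\<nu> = \<nu>'"
      moreover have "sup_dist (Pi\<^sub>M H P) (\<nu> H) (\<nu> H) \<le> 0" if "H \<subseteq> J" for H
        using Metric_space.mdist_zero[OF S] zm_familiesD[OF F(1) that] by simp
      ultimately show "family_dist P J \<nu> \<nu>' = 0"
        using least[OF F, of 0] nonneg by force
    qed
  next
    fix \<nu> \<nu>' \<nu>''
    assume F: "\<nu> \<in> zm_families P J" "\<nu>' \<in> zm_families P J" "\<nu>'' \<in> zm_families P J"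
    show "family_dist P J \<nu> \<nu>'' \<le> family_dist P J \<nu> \<nu>' + family_dist P J \<nu>' \<nu>''"
    proof (rule least[OF F(1,3)])
      fix H assume H: "H \<subseteq> J"
      have "sup_dist (Pi\<^sub>M H P) (\<nu> H) (\<nu>'' H) \<le>
          sup_dist (Pi\<^sub>M H P) (\<nu> H) (\<nu>' H) + sup_dist (Pi\<^sub>M H P) (\<nu>' H) (\<nu>'' H)"
        using F H by (intro Metric_space.triangle[OF S] zm_familiesD)
      also have "\<dots> \<le> family_dist P J \<nu> \<nu>' + family_dist P J \<nu>' \<nu>''"
        using upper[OF F(1,2) H] upper[OF F(2,3) H] by (rule add_mono)
      finally show "sup_dist (Pi\<^sub>M H P) (\<nu> H) (\<nu>'' H) \<le>
          family_dist P J \<nu> \<nu>' + family_dist P J \<nu>' \<nu>''" .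
    qed
  qed
qed

end

theory Submission
  imports Defs
begin

text \<open>
  The components are given by Moebius inversion. Write \<open>\<mu>\<^sup>K\<close> for the marginal of \<open>\<mu>\<close> on \<open>K\<close>. Setting
  \<open>A j\<close> to the whole space for \<open>j \<notin> L\<close> kills the terms with \<open>H \<not>\<subseteq> L\<close> of a decomposition, so that
  \<open>\<mu>\<^sup>L\<close> is the sum of \<open>P\<^bsub>L - H\<^esub> \<otimes> \<mu>\<^bsub>H\<^esub>\<close> over \<open>H \<subseteq> L\<close> on rectangles
  (\<open>marginal_decomposition\<close>). This triangular system determines \<open>\<mu>\<^bsub>L\<^esub>\<close> on rectangles by induction on
  \<open>L\<close>, hence everywhere, because rectangles form a generating \<open>\<inter>\<close>-stable family
  (\<open>zm_decomposition_unique\<close>). It is solved by the alternating sum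
  \<open>\<mu>\<^bsub>H\<^esub> = (\<Sum>K\<subseteq>H. (-1)\<^bsup>card (H - K)\<^esup> \<mu>\<^sup>K \<otimes> P\<^bsub>H - K\<^esub>)\<close>: its marginals vanish because the terms for \<open>K\<close>
  and \<open>insert i K\<close> cancel when \<open>A i\<close> is the whole space (\<open>zm_component_zm_measures\<close>), and it
  recovers \<open>\<mu>\<close> because the sum of \<open>(-1)\<^bsup>card (H - K)\<^esup>\<close> over \<open>K \<subseteq> H \<subseteq> J\<close> is \<open>0\<close> unless \<open>K = J\<close>
  (\<open>is_zm_decomposition_zm_component\<close>).

  The product \<open>\<mu>\<^sup>K \<otimes> P\<^bsub>H - K\<^esub>\<close> needs no Jordan decomposition of \<open>\<mu>\<close>: its value at \<open>B\<close> is the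
  expectation, over \<open>y\<close> with law \<open>P\<^bsub>J\<^esub>\<close>, of the \<open>\<mu>\<close>-measure of the set of those \<open>x\<close> for which the
  point with coordinates \<open>x j\<close> for \<open>j \<in> K\<close> and \<open>y j\<close> for \<open>j \<in> H - K\<close> lies in \<open>B\<close>. Since signed
  measures are bounded, dominated convergence makes this a signed measure, visibly linear in \<open>\<mu>\<close> and
  of supremum norm at most that of \<open>\<mu>\<close>. Hence \<open>\<mu> \<mapsto> \<mu>\<^bsub>H\<^esub>\<close> is linear with norm at most
  \<open>2\<^bsup>card J\<^esup>\<close>, which is the continuity (\<open>family_dist_zm_decomposition\<close>).
\<close>

section \<open>Finite signed measures\<close>

lemma finite_signed_measures_empty: "\<mu> \<in> finite_signed_measures M \<Longrightarrow> \<mu> {} = 0"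
  by (simp add: finite_signed_measures_def)

lemma finite_signed_measures_sums:
  "\<mu> \<in> finite_signed_measures M \<Longrightarrow> range A \<subseteq> sets M \<Longrightarrow> disjoint_family A \<Longrightarrow>
    (\<lambda>i::nat. \<mu> (A i)) sums \<mu> (\<Union>i. A i)"
  by (simp add: finite_signed_measures_def)

lemma finite_signed_measures_notin:
  "\<mu> \<in> finite_signed_measures M \<Longrightarrow> A \<notin> sets M \<Longrightarrow> \<mu> A = 0"
  by (simp add: finite_signed_measures_def)

lemma finite_signed_measures_compl:
  assumes "\<mu> \<in> finite_signed_measures M" "A \<in> sets M"
  shows "\<mu> (space M - A) = \<mu> (space M) - \<mu> A"
  using finite_signed_measure_Un[OF assms(1), of A "space M - A"] assms
    sets.sets_into_space[OF assms(2)]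
  by (simp add: Un_absorb1)

lemma finite_signed_measures_sum:
  assumes "\<And>i. i \<in> I \<Longrightarrow> \<mu> i \<in> finite_signed_measures M"
  shows "(\<lambda>A. \<Sum>i\<in>I. c i * \<mu> i A) \<in> finite_signed_measures M"
  unfolding finite_signed_measures_def
  by (auto intro!: sums_sum sums_mult finite_signed_measures_sums assms
      simp: finite_signed_measures_empty[OF assms] finite_signed_measures_notin[OF assms])

lemma finite_signed_measures_linear:
  assumes "\<mu> \<in> finite_signed_measures M" "\<nu> \<in> finite_signed_measures M"
  shows "(\<lambda>A. a * \<mu> A + b * \<nu> A) \<in> finite_signed_measures M"
  unfolding finite_signed_measures_def using assms
  by (auto intro!: sums_add sums_mult finite_signed_measures_sums
      simp: finite_signed_measures_empty finite_signed_measures_notin)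

lemma finite_signed_measures_eqI_generator:
  assumes \<mu>: "\<mu> \<in> finite_signed_measures M" and \<nu>: "\<nu> \<in> finite_signed_measures M"
    and stable: "Int_stable E" and E: "E \<subseteq> Pow (space M)" "space M \<in> E"
    and sets: "sets M = sigma_sets (space M) E"
    and eq: "\<And>A. A \<in> E \<Longrightarrow> \<mu> A = \<nu> A"
  shows "\<mu> = \<nu>"
proof
  fix A
  show "\<mu> A = \<nu> A"
  proof (cases "A \<in> sets M")
    case True
    then have "A \<in> sigma_sets (space M) E" by (simp add: sets)
    with stable E(1) show ?thesis
    proof (induction rule: sigma_sets_induct_disjoint)
      case (compl A)
      then show ?case
        using eq[OF E(2)] by (simp add: finite_signed_measures_compl[OF \<mu>]
            finite_signed_measures_compl[OF \<nu>] sets)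
    next
      case (union A)
      then have "range A \<subseteq> sets M" by (simp add: sets)
      then have "(\<lambda>i. \<mu> (A i)) sums \<mu> (\<Union>i. A i)" "(\<lambda>i. \<nu> (A i)) sums \<nu> (\<Union>i. A i)"
        using union(1) by (auto intro!: finite_signed_measures_sums[OF \<mu>]
            finite_signed_measures_sums[OF \<nu>])
      then show ?case using union(3) by (metis (no_types, lifting) sums_cong sums_unique2)
    qed (simp_all add: eq finite_signed_measures_empty[OF \<mu>] finite_signed_measures_empty[OF \<nu>])
  qed (simp add: finite_signed_measures_notin[OF \<mu>] finite_signed_measures_notin[OF \<nu>])
qed

lemma sets_PiM_PiE:
  assumes "finite I"
  shows "sets (Pi\<^sub>M I P) =
    sigma_sets (space (Pi\<^sub>M I P)) {Pi\<^sub>E I A | A. \<forall>i\<in>I. A i \<in> sets (P i)}"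
  unfolding sets_PiM space_PiM prod_algebra_eq_finite[OF assms]
  by (rule arg_cong[where f = "sigma_sets _"]) (auto simp: Pi_iff)

lemma finite_signed_measures_PiM_eqI:
  assumes I: "finite I"
    and \<mu>: "\<mu> \<in> finite_signed_measures (Pi\<^sub>M I P)" and \<nu>: "\<nu> \<in> finite_signed_measures (Pi\<^sub>M I P)"
    and eq: "\<And>A. (\<And>i. i \<in> I \<Longrightarrow> A i \<in> sets (P i)) \<Longrightarrow> \<mu> (Pi\<^sub>E I A) = \<nu> (Pi\<^sub>E I A)"
  shows "\<mu> = \<nu>"
proof (rule finite_signed_measures_eqI_generator[OF \<mu> \<nu> Int_stable_PiE _ _ sets_PiM_PiE[OF I]])
  show "{Pi\<^sub>E I A | A. \<forall>i\<in>I. A i \<in> sets (P i)} \<subseteq> Pow (space (Pi\<^sub>M I P))"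
    using sets.sets_into_space by (fastforce simp: space_PiM)
  show "space (Pi\<^sub>M I P) \<in> {Pi\<^sub>E I A | A. \<forall>i\<in>I. A i \<in> sets (P i)}"
    by (auto simp: space_PiM)
qed (use eq in auto)


section \<open>Averaged images of a signed measure\<close>

lemma section_in_sets:
  assumes "y \<in> space Q" "C \<in> sets (M \<Otimes>\<^sub>M Q)"
  shows "{x \<in> space M. (x, y) \<in> C} \<in> sets M"
proof -
  have "{x \<in> space M. (x, y) \<in> C} = (\<lambda>x. (x, y)) -` C"
    using sets.sets_into_space[OF assms(2)] by (auto simp: space_pair_measure)
  then show ?thesis using sets_Pair2[OF assms(2)] by simp
qed

text \<open>
  The sections of a fixed measurable set of the product have a \<open>\<mu>\<close>-measure that depends measurably
  on the second coordinate. The sets with this property contain the rectangles and are closed under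
  complements and countable disjoint unions.
\<close>

lemma finite_signed_measures_section_measurable:
  assumes \<mu>: "\<mu> \<in> finite_signed_measures M" and C: "C \<in> sets (M \<Otimes>\<^sub>M Q)"
  shows "(\<lambda>y. \<mu> {x \<in> space M. (x, y) \<in> C}) \<in> borel_measurable Q"
proof -
  let ?s = "\<lambda>C y. {x \<in> space M. (x, y) \<in> C}"
  from Int_stable_pair_measure_generator[of M Q] pair_measure_closed[of M Q]
    C[unfolded sets_pair_measure]
  show ?thesis
  proof (induction rule: sigma_sets_induct_disjoint)
    case (basic C)
    then obtain A B where AB: "C = A \<times> B" "A \<in> sets M" "B \<in> sets Q" by auto
    have "\<mu> (?s C y) = indicator B y * \<mu> A" for y
      using AB sets.sets_into_space[OF AB(2)] finite_signed_measures_empty[OF \<mu>]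
      by (cases "y \<in> B") (auto intro!: arg_cong[where f = \<mu>])
    then show ?case using AB by simp
  next
    case empty
    then show ?case by simp
  next
    case (compl C)
    then have C: "C \<in> sets (M \<Otimes>\<^sub>M Q)" by (simp add: sets_pair_measure)
    have *: "\<mu> (?s (space M \<times> space Q - C) y) = \<mu> (space M) - \<mu> (?s C y)" if y: "y \<in> space Q" for y
    proof -
      have "?s (space M \<times> space Q - C) y = space M - ?s C y" using y by auto
      then show ?thesis
        using finite_signed_measures_compl[OF \<mu> section_in_sets[OF y C]] by simp
    qed
    show ?case 
      using borel_measurable_diff[OF borel_measurable_const compl.IH]
      by (rule measurable_cong[THEN iffD2, OF *, rotated])
  next
    case (union C)
    have C: "C i \<in> sets (M \<Otimes>\<^sub>M Q)" for i using union(2) by (auto simp: sets_pair_measure)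
    have *: "\<mu> (?s (\<Union>i. C i) y) = (\<Sum>i. \<mu> (?s (C i) y))" if y: "y \<in> space Q" for y
    proof -
      have "(\<lambda>i. \<mu> (?s (C i) y)) sums \<mu> (\<Union>i. ?s (C i) y)"
        using union(1) section_in_sets[OF y C]
        by (intro finite_signed_measures_sums[OF \<mu>]) (auto simp: disjoint_family_on_def)
      moreover have "(\<Union>i. ?s (C i) y) = ?s (\<Union>i. C i) y" by auto
      ultimately show ?thesis by (simp add: sums_iff)
    qed
    show ?case
      using borel_measurable_suminf[OF union.IH]
      by (rule measurable_cong[THEN iffD2, OF *, rotated])
  qed
qed

text \<open>
  For a random point \<open>y\<close> with law \<open>Q\<close>, this is the average over \<open>y\<close> of the image of \<open>\<mu>\<close> under
  \<open>x \<mapsto> g (x, y)\<close>; in other words, the image of the product of \<open>\<mu>\<close> and \<open>Q\<close> under \<open>g\<close>.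
  As for all signed measures here, the value is \<open>0\<close> on non-measurable sets.
\<close>

definition averaged_image ::
    "'a measure \<Rightarrow> 'b measure \<Rightarrow> 'c measure \<Rightarrow> ('a \<times> 'b \<Rightarrow> 'c) \<Rightarrow> ('a set \<Rightarrow> real) \<Rightarrow> 'c set \<Rightarrow> real" where
  "averaged_image M Q N g \<mu> B =
     (if B \<in> sets N then (\<integral>y. \<mu> {x \<in> space M. g (x, y) \<in> B} \<partial>Q) else 0)"

locale averaging = Q: prob_space Q for Q :: "'b measure" +
  fixes M :: "'a measure" and N :: "'c measure" and g :: "'a \<times> 'b \<Rightarrow> 'c"
  assumes g [measurable]: "g \<in> measurable (M \<Otimes>\<^sub>M Q) N"
begin

lemma slice_eq:
  assumes "y \<in> space Q"
  shows "{x \<in> space M. g (x, y) \<in> B} = {x \<in> space M. (x, y) \<in> g -` B \<inter> space (M \<Otimes>\<^sub>M Q)}"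
  using assms by (auto simp: space_pair_measure)

lemma slice_in_sets:
  assumes "y \<in> space Q" "B \<in> sets N"
  shows "{x \<in> space M. g (x, y) \<in> B} \<in> sets M"
  using section_in_sets[OF assms(1) measurable_sets[OF g assms(2)]] slice_eq[OF assms(1)] by simp

lemma measurable_slice:
  assumes "\<mu> \<in> finite_signed_measures M" "B \<in> sets N"
  shows "(\<lambda>y. \<mu> {x \<in> space M. g (x, y) \<in> B}) \<in> borel_measurable Q"
  using finite_signed_measures_section_measurable[OF assms(1) measurable_sets[OF g assms(2)]]
  by (subst measurable_cong[OF arg_cong[where f = \<mu>, OF slice_eq]])

lemma integrable_slice:
  assumes \<mu>: "\<mu> \<in> finite_signed_measures M" and B: "B \<in> sets N"
  shows "integrable Q (\<lambda>y. \<mu> {x \<in> space M. g (x, y) \<in> B})"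
proof -
  obtain C where "\<And>A. A \<in> sets M \<Longrightarrow> \<bar>\<mu> A\<bar> \<le> C"
    using finite_signed_measure_bounded[OF \<mu>] by blast
  then show ?thesis
    using measurable_slice[OF \<mu> B] slice_in_sets[OF _ B]
    by (intro Q.integrable_const_bound[where B = C]) auto
qed

lemma averaged_image_bound:
  assumes \<mu>: "\<mu> \<in> finite_signed_measures M" and C: "\<And>A. A \<in> sets M \<Longrightarrow> \<bar>\<mu> A\<bar> \<le> C"
  shows "\<bar>averaged_image M Q N g \<mu> B\<bar> \<le> C"
proof (cases "B \<in> sets N")
  case True
  let ?f = "\<lambda>y. \<mu> {x \<in> space M. g (x, y) \<in> B}"
  have "\<bar>\<integral>y. ?f y \<partial>Q\<bar> \<le> (\<integral>y. \<bar>?f y\<bar> \<partial>Q)"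
    by (rule integral_abs_bound)
  also have "\<dots> \<le> (\<integral>y. C \<partial>Q)"
    using integrable_slice[OF \<mu> True] slice_in_sets[OF _ True] C
    by (intro integral_mono) auto
  finally show ?thesis by (simp add: averaged_image_def True Q.prob_space)
next
  case False
  have "0 \<le> C" using C[of "{}"] finite_signed_measures_empty[OF \<mu>] by simp
  then show ?thesis by (simp add: averaged_image_def False)
qed

lemma averaged_image_linear:
  assumes "\<mu> \<in> finite_signed_measures M" "\<nu> \<in> finite_signed_measures M"
  shows "averaged_image M Q N g (\<lambda>A. a * \<mu> A + b * \<nu> A) B =
    a * averaged_image M Q N g \<mu> B + b * averaged_image M Q N g \<nu> B"
  using integrable_slice[OF assms(1), of B] integrable_slice[OF assms(2), of B]
  by (simp add: averaged_image_def)

lemma averaged_image_finite_signed_measures: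
  assumes \<mu>: "\<mu> \<in> finite_signed_measures M"
  shows "averaged_image M Q N g \<mu> \<in> finite_signed_measures N"
proof -
  let ?s = "\<lambda>B y. {x \<in> space M. g (x, y) \<in> B}"
  obtain C where C: "\<And>A. A \<in> sets M \<Longrightarrow> \<bar>\<mu> A\<bar> \<le> C"
    using finite_signed_measure_bounded[OF \<mu>] by blast
  have "(\<lambda>i. averaged_image M Q N g \<mu> (B i)) sums averaged_image M Q N g \<mu> (\<Union>i. B i)"
    if B: "range B \<subseteq> sets N" and disj: "disjoint_family B" for B :: "nat \<Rightarrow> 'c set"
  proof -
    have Bi: "B i \<in> sets N" for i using B by auto
    have UN: "(\<Union>i. B i) \<in> sets N" using Bi by auto
    have part: "(\<Union>i<n. B i) \<in> sets N" for n using Bi by auto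
    have sums: "(\<lambda>i. \<mu> (?s (B i) y)) sums \<mu> (?s (\<Union>i. B i) y)" if y: "y \<in> space Q" for y
    proof -
      have "(\<lambda>i. \<mu> (?s (B i) y)) sums \<mu> (\<Union>i. ?s (B i) y)"
        using slice_in_sets[OF y Bi] disj
        by (intro finite_signed_measures_sums[OF \<mu>]) (auto simp: disjoint_family_on_def)
      moreover have "(\<Union>i. ?s (B i) y) = ?s (\<Union>i. B i) y" by auto
      ultimately show ?thesis by simp
    qed
    \<comment> \<open>Finite additivity keeps all partial sums below the bound of \<open>\<mu>\<close>, as dominated
      convergence requires.\<close>
    have partial: "(\<Sum>i<n. \<mu> (?s (B i) y)) = \<mu> (?s (\<Union>i<n. B i) y)" if y: "y \<in> space Q" for n y
    proof (induction n)
      case 0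
      then show ?case by (simp add: finite_signed_measures_empty[OF \<mu>])
    next
      case (Suc n)
      have "?s (\<Union>i<n. B i) y \<inter> ?s (B n) y = {}"
      proof -
        have "B i \<inter> B n = {}" if "i < n" for i
          using disj that by (simp add: disjoint_family_on_def)
        then show ?thesis by blast
      qed
      then have "\<mu> (?s (\<Union>i<n. B i) y \<union> ?s (B n) y) = \<mu> (?s (\<Union>i<n. B i) y) + \<mu> (?s (B n) y)"
        using slice_in_sets[OF y part] slice_in_sets[OF y Bi]
        by (intro finite_signed_measure_Un[OF \<mu>])
      moreover have "?s (\<Union>i<Suc n. B i) y = ?s (\<Union>i<n. B i) y \<union> ?s (B n) y"
        by (auto simp: lessThan_Suc)
      ultimately show ?case using Suc by simp
    qed
    have "(\<lambda>n. \<integral>y. (\<Sum>i<n. \<mu> (?s (B i) y)) \<partial>Q) \<longlonglongrightarrow> (\<integral>y. \<mu> (?s (\<Union>i. B i) y) \<partial>Q)"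
    proof (rule integral_dominated_convergence[where w = "\<lambda>_. C"])
      show "AE y in Q. (\<lambda>n. \<Sum>i<n. \<mu> (?s (B i) y)) \<longlonglongrightarrow> \<mu> (?s (\<Union>i. B i) y)"
        using sums by (auto simp: sums_def)
      show "AE y in Q. norm (\<Sum>i<n. \<mu> (?s (B i) y)) \<le> C" for n
        using C slice_in_sets[OF _ part[of n]] by (auto simp: partial)
    qed (use measurable_slice[OF \<mu> UN] measurable_slice[OF \<mu> Bi] in auto)
    moreover have "(\<integral>y. (\<Sum>i<n. \<mu> (?s (B i) y)) \<partial>Q) = (\<Sum>i<n. averaged_image M Q N g \<mu> (B i))" for n
      using integrable_slice[OF \<mu> Bi] by (simp add: averaged_image_def Bi)
    ultimately show ?thesis
      using Bi by (simp add: sums_def averaged_image_def)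
  qed
  then show ?thesis
    by (simp add: finite_signed_measures_def averaged_image_def finite_signed_measures_empty[OF \<mu>])
qed

end


section \<open>Alternating sums over subsets\<close>

text \<open>
  With \<open>U = H - K\<close> ranging over the subsets of \<open>J - K\<close>, the sum is the expansion of a product of
  \<open>card (J - K)\<close> factors \<open>-1 + 1\<close>.
\<close>

lemma sum_alternating_supersets:
  assumes "finite J" "K \<subseteq> J"
  shows "(\<Sum>H | H \<subseteq> J \<and> K \<subseteq> H. (-1 :: 'r :: comm_ring_1) ^ card (H - K)) = (if K = J then 1 else 0)"
proof -
  have fin: "finite (J - K)" using assms by simp
  have "(\<Sum>H | H \<subseteq> J \<and> K \<subseteq> H. (-1 :: 'r) ^ card (H - K)) = (\<Sum>U\<in>Pow (J - K). (-1) ^ card U)"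
    using assms
    by (intro sum.reindex_bij_witness[where i = "\<lambda>U. K \<union> U" and j = "\<lambda>H. H - K"])
      (auto intro!: arg_cong[where f = "\<lambda>S. (-1) ^ card S"])
  also have "\<dots> = (\<Prod>j\<in>J - K. -1 + 1)"
    unfolding prod_add[OF fin] by simp
  also have "\<dots> = (if K = J then 1 else 0)"
  proof (cases "K = J")
    case False
    then have "0 < card (J - K)" using assms fin by (auto simp: card_gt_0_iff)
    then show ?thesis using False by (simp add: power_0_left del: card_0_eq)
  qed simp
  finally show ?thesis .
qed

lemma sum_alternating_subsets_pair:
  fixes f :: "'i set \<Rightarrow> 'r :: comm_ring_1"
  assumes "finite H" "i \<in> H"
    and f: "\<And>K. K \<subseteq> H - {i} \<Longrightarrow> f (insert i K) = f K"
  shows "(\<Sum>K\<in>Pow H. (-1) ^ card (H - K) * f K) = 0"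
proof -
  define G where "G = H - {i}"
  have H: "H = insert i G" "i \<notin> G" "finite G" using assms by (auto simp: G_def)
  have inj: "inj_on (insert i) (Pow G)" using H(2) by (auto simp: inj_on_def insert_ident)
  have "(\<Sum>K\<in>Pow H. (-1) ^ card (H - K) * f K) =
      (\<Sum>K\<in>Pow G. (-1) ^ card (H - K) * f K) + (\<Sum>K\<in>Pow G. (-1) ^ card (H - insert i K) * f (insert i K))"
    unfolding H(1) Pow_insert using H
    by (subst sum.union_disjoint) (auto simp: sum.reindex[OF inj])
  also have "\<dots> = (\<Sum>K\<in>Pow G. (-1) ^ card (H - K) * f K + (-1) ^ card (H - insert i K) * f (insert i K))"
    by (simp add: sum.distrib)
  also have "\<dots> = 0"
  proof (rule sum.neutral, rule ballI)
    fix K assume "K \<in> Pow G"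
    then have K: "K \<subseteq> G" by simp
    have "H - K = insert i (G - K)" "H - insert i K = G - K" using H K by auto
    then have "card (H - K) = Suc (card (H - insert i K))" using H by simp
    then show "(-1) ^ card (H - K) * f K + (-1) ^ card (H - insert i K) * f (insert i K) = 0"
      using f[of K] K by (simp add: G_def)
  qed
  finally show ?thesis .
qed


section \<open>The components of the decomposition\<close>

text \<open>
  The value of \<open>\<mu>\<close> on the cylinder that restricts exactly the coordinates in \<open>K\<close>, the one in
  direction \<open>j\<close> to \<open>A j\<close>. This is the marginal of \<open>\<mu>\<close> on \<open>K\<close> at a rectangle, read on the full
  product.
\<close>

definition marginal ::
    "('i \<Rightarrow> 'a measure) \<Rightarrow> 'i set \<Rightarrow> (('i \<Rightarrow> 'a) set \<Rightarrow> real) \<Rightarrow> ('i \<Rightarrow> 'a set) \<Rightarrow> 'i set \<Rightarrow> real" where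
  "marginal P J \<mu> A K = \<mu> (\<Pi>\<^sub>E j\<in>J. if j \<in> K then A j else space (P j))"

text \<open>The point of the product over \<open>H\<close> that takes its coordinates in \<open>K\<close> from \<open>x\<close> and the others
  from \<open>y\<close>.\<close>

definition mix :: "'i set \<Rightarrow> 'i set \<Rightarrow> ('i \<Rightarrow> 'a) \<times> ('i \<Rightarrow> 'a) \<Rightarrow> 'i \<Rightarrow> 'a" where
  "mix H K = (\<lambda>(x, y). \<lambda>j\<in>H. if j \<in> K then x j else y j)"

text \<open>
  For \<open>K \<subseteq> H\<close>, the product of the marginal of \<open>\<mu>\<close> on \<open>K\<close> with the probability measures \<open>P j\<close>,
  \<open>j \<in> H - K\<close>. Both arguments of \<open>mix H K\<close> range over the product over \<open>J\<close>: its values depend only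
  on the coordinates of \<open>x\<close> in \<open>K\<close> and of \<open>y\<close> in \<open>H - K\<close>, so the remaining coordinates are integrated
  out.
\<close>

definition marginal_times ::
    "('i \<Rightarrow> 'a measure) \<Rightarrow> 'i set \<Rightarrow> 'i set \<Rightarrow> 'i set \<Rightarrow> (('i \<Rightarrow> 'a) set \<Rightarrow> real) \<Rightarrow>
     ('i \<Rightarrow> 'a) set \<Rightarrow> real" where
  "marginal_times P J H K = averaged_image (Pi\<^sub>M J P) (Pi\<^sub>M J P) (Pi\<^sub>M H P) (mix H K)"

text \<open>
  The component \<open>\<mu>\<^bsub>H\<^esub>\<close>, for \<open>H \<subseteq> J\<close>: the Moebius inversion of the marginals, each completed to a signed
  measure on the product over \<open>H\<close>.
\<close>

definition zm_component ::
    "('i \<Rightarrow> 'a measure) \<Rightarrow> 'i set \<Rightarrow> (('i \<Rightarrow> 'a) set \<Rightarrow> real) \<Rightarrow> 'i set \<Rightarrow> ('i \<Rightarrow> 'a) set \<Rightarrow> real" where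
  "zm_component P J \<mu> H B = (\<Sum>K\<in>Pow H. (-1) ^ card (H - K) * marginal_times P J H K \<mu> B)"

locale finite_prob_family =
  fixes P :: "'i \<Rightarrow> 'a measure" and J :: "'i set"
  assumes finite_J: "finite J" and prob_space_P: "\<And>j. j \<in> J \<Longrightarrow> prob_space (P j)"
begin

lemma finite_subset_J: "H \<subseteq> J \<Longrightarrow> finite H"
  using finite_J by (rule finite_subset[rotated])

lemma measure_PiM_PiE:
  assumes "H \<subseteq> J" "\<And>j. j \<in> H \<Longrightarrow> A j \<in> sets (P j)"
  shows "measure (Pi\<^sub>M H P) (Pi\<^sub>E H A) = (\<Prod>j\<in>H. measure (P j) (A j))"
proof -
  \<comment> \<open>Outside \<open>J\<close> nothing is known about \<open>P\<close>; replacing the factors outside \<open>H\<close> by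
    trivial ones leaves the product over \<open>H\<close> unchanged.\<close>
  define P' where "P' j = (if j \<in> H then P j else count_space {undefined})" for j
  have "prob_space (P' j)" for j
  proof (cases "j \<in> H")
    case True
    then show ?thesis using prob_space_P assms(1) by (simp add: P'_def subsetD)
  next
    case False
    then show ?thesis by (auto simp: P'_def intro: prob_spaceI)
  qed
  then have "product_prob_space P'" by (rule product_prob_spaceI)
  then interpret P': finite_product_prob_space P' H
    using finite_subset_J[OF assms(1)]
    by (simp add: finite_product_prob_space_def product_prob_space_def
        finite_product_sigma_finite_def finite_product_sigma_finite_axioms_def)
  have "Pi\<^sub>M H P = Pi\<^sub>M H P'" by (rule PiM_cong) (auto simp: P'_def)
  moreover have "measure (Pi\<^sub>M H P') (Pi\<^sub>E H A) = (\<Prod>j\<in>H. measure (P' j) (A j))"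
    using assms(2) by (intro P'.prob_times) (simp add: P'_def)
  moreover have "\<dots> = (\<Prod>j\<in>H. measure (P j) (A j))"
    by (rule prod.cong) (simp_all add: P'_def)
  ultimately show ?thesis by simp
qed

lemma measurable_mix:
  assumes "H \<subseteq> J"
  shows "mix H K \<in> measurable (Pi\<^sub>M J P \<Otimes>\<^sub>M Pi\<^sub>M J P) (Pi\<^sub>M H P)"
proof -
  have "(\<lambda>z. \<lambda>j\<in>H. if j \<in> K then fst z j else snd z j) \<in>
      measurable (Pi\<^sub>M J P \<Otimes>\<^sub>M Pi\<^sub>M J P) (Pi\<^sub>M H P)"
  proof (rule measurable_restrict)
    fix j assume "j \<in> H"
    then have j: "j \<in> J" using assms by auto
    show "(\<lambda>z. if j \<in> K then fst z j else snd z j) \<in> measurable (Pi\<^sub>M J P \<Otimes>\<^sub>M Pi\<^sub>M J P) (P j)"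
      using measurable_compose[OF measurable_fst measurable_component_singleton[OF j]]
        measurable_compose[OF measurable_snd measurable_component_singleton[OF j]]
      by (cases "j \<in> K") simp_all
  qed
  then show ?thesis by (simp add: mix_def case_prod_beta')
qed

lemma averaging_mix:
  assumes "H \<subseteq> J"
  shows "averaging (Pi\<^sub>M J P) (Pi\<^sub>M J P) (Pi\<^sub>M H P) (mix H K)"
  using prob_space_PiM[OF prob_space_P] measurable_mix[OF assms]
  by (simp add: averaging_def averaging_axioms_def)

lemma marginal_times_PiE:
  assumes \<mu>: "\<mu> \<in> finite_signed_measures (Pi\<^sub>M J P)" and H: "H \<subseteq> J" and K: "K \<subseteq> H"
    and A: "\<And>j. j \<in> H \<Longrightarrow> A j \<in> sets (P j)"
  shows "marginal_times P J H K \<mu> (Pi\<^sub>E H A) =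
    (\<Prod>j\<in>H - K. measure (P j) (A j)) * marginal P J \<mu> A K"
proof -
  let ?C = "\<Pi>\<^sub>E j\<in>J. if j \<in> K then A j else space (P j)"
  let ?D = "\<Pi>\<^sub>E j\<in>J. if j \<in> H - K then A j else space (P j)"
  have sub: "A j \<subseteq> space (P j)" if "j \<in> H" for j using A[OF that] by (rule sets.sets_into_space)
  have D: "?D \<in> sets (Pi\<^sub>M J P)"
    using A by (intro sets_PiM_I_finite finite_J) auto
  \<comment> \<open>The conditions on \<open>x\<close> and on \<open>y\<close> separate, so the integrand is a multiple of an indicator.\<close>
  have slice: "\<mu> {x \<in> space (Pi\<^sub>M J P). mix H K (x, y) \<in> Pi\<^sub>E H A} = indicator ?D y * \<mu> ?C"
    if y: "y \<in> space (Pi\<^sub>M J P)" for y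
  proof (cases "\<forall>j\<in>H - K. y j \<in> A j")
    case True
    then have "y \<in> ?D" using y by (auto simp: space_PiM PiE_iff)
    moreover have "{x \<in> space (Pi\<^sub>M J P). mix H K (x, y) \<in> Pi\<^sub>E H A} = ?C"
    proof (intro set_eqI iffI)
      fix x assume x: "x \<in> {x \<in> space (Pi\<^sub>M J P). mix H K (x, y) \<in> Pi\<^sub>E H A}"
      have "x j \<in> A j" if "j \<in> K" for j
        using x that K PiE_mem[of "mix H K (x, y)" H A j] by (auto simp: mix_def)
      then show "x \<in> ?C" using x by (auto simp: space_PiM PiE_iff)
    next
      fix x assume x: "x \<in> ?C"
      have "x j \<in> space (P j)" if "j \<in> J" for j
        using PiE_mem[OF x that] sub[of j] K by (cases "j \<in> K") auto
      moreover have "x j \<in> A j" if "j \<in> K" for j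
        using x that H K by (auto simp: PiE_iff dest!: bspec[of _ _ j])
      ultimately show "x \<in> {x \<in> space (Pi\<^sub>M J P). mix H K (x, y) \<in> Pi\<^sub>E H A}"
        using x True by (auto simp: space_PiM PiE_iff mix_def)
    qed
    ultimately show ?thesis by simp
  next
    case False
    then obtain j where j: "j \<in> H" "j \<notin> K" "y j \<notin> A j" by auto
    then have "y \<notin> ?D" using H by (auto simp: PiE_iff dest!: bspec[of _ _ j])
    then have "indicator ?D y = (0 :: real)" by (rule indicator_simps)
    moreover have "{x \<in> space (Pi\<^sub>M J P). mix H K (x, y) \<in> Pi\<^sub>E H A} = {}"
      using j by (auto simp: PiE_iff mix_def dest!: bspec[of _ _ j])
    ultimately show ?thesis
      by (simp only: finite_signed_measures_empty[OF \<mu>] mult_zero_left)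
  qed
  have "Pi\<^sub>E H A \<in> sets (Pi\<^sub>M H P)"
    using A finite_subset_J[OF H] by (intro sets_PiM_I_finite) auto
  then have "marginal_times P J H K \<mu> (Pi\<^sub>E H A) = (\<integral>y. indicator ?D y * \<mu> ?C \<partial>Pi\<^sub>M J P)"
    using slice by (simp add: marginal_times_def averaged_image_def cong: Bochner_Integration.integral_cong)
  also have "\<dots> = measure (Pi\<^sub>M J P) ?D * \<mu> ?C"
    using D by (simp add: sets.Int_space_eq2)
  also have "measure (Pi\<^sub>M J P) ?D = (\<Prod>j\<in>J. measure (P j) (if j \<in> H - K then A j else space (P j)))"
    using A by (intro measure_PiM_PiE) auto
  also have "\<dots> = (\<Prod>j\<in>H - K. measure (P j) (A j))"
    using H prob_space.prob_space[OF prob_space_P]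
    by (intro prod.mono_neutral_cong_right finite_J) auto
  finally show ?thesis by (simp add: marginal_def)
qed

lemma zm_component_PiE:
  assumes \<mu>: "\<mu> \<in> finite_signed_measures (Pi\<^sub>M J P)" and H: "H \<subseteq> J"
    and A: "\<And>j. j \<in> H \<Longrightarrow> A j \<in> sets (P j)"
  shows "zm_component P J \<mu> H (Pi\<^sub>E H A) =
    (\<Sum>K\<in>Pow H. (-1) ^ card (H - K) * ((\<Prod>j\<in>H - K. measure (P j) (A j)) * marginal P J \<mu> A K))"
  unfolding zm_component_def using assms
  by (intro sum.cong) (auto simp: marginal_times_PiE)

lemma zm_component_zm_measures:
  assumes \<mu>: "\<mu> \<in> finite_signed_measures (Pi\<^sub>M J P)" and H: "H \<subseteq> J"
  shows "zm_component P J \<mu> H \<in> zm_measures P H"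
proof -
  have "(\<lambda>B. \<Sum>K\<in>Pow H. (-1) ^ card (H - K) * marginal_times P J H K \<mu> B)
      \<in> finite_signed_measures (Pi\<^sub>M H P)"
    unfolding marginal_times_def
    by (intro finite_signed_measures_sum averaging.averaged_image_finite_signed_measures
        averaging_mix H \<mu>)
  then have "zm_component P J \<mu> H \<in> finite_signed_measures (Pi\<^sub>M H P)"
    by (simp add: zm_component_def[abs_def])
  moreover have "zm_component P J \<mu> H (Pi\<^sub>E H A) = 0"
    if A: "\<And>j. j \<in> H \<Longrightarrow> A j \<in> sets (P j)" and i: "i \<in> H" "A i = space (P i)" for A i
  proof (subst zm_component_PiE[OF \<mu> H A],
      simp, rule sum_alternating_subsets_pair[OF finite_subset_J[OF H] i(1)])
    fix K assume K: "K \<subseteq> H - {i}"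
    \<comment> \<open>Restricting direction \<open>i\<close> to the whole space changes neither factor.\<close>
    have "marginal P J \<mu> A (insert i K) = marginal P J \<mu> A K"
      unfolding marginal_def using i by (intro arg_cong[where f = \<mu>] PiE_cong) auto
    moreover have "H - K - {i} = H - insert i K" "i \<in> H - K" using i K by auto
    then have "(\<Prod>j\<in>H - K. measure (P j) (A j)) =
        measure (P i) (A i) * (\<Prod>j\<in>H - insert i K. measure (P j) (A j))"
      using finite_subset_J[OF H] prod.remove[of "H - K" i "\<lambda>j. measure (P j) (A j)"] by simp
    moreover have "measure (P i) (A i) = 1"
      using i H prob_space.prob_space[OF prob_space_P] by auto
    ultimately show "(\<Prod>j\<in>H - insert i K. measure (P j) (A j)) * marginal P J \<mu> A (insert i K) =
        (\<Prod>j\<in>H - K. measure (P j) (A j)) * marginal P J \<mu> A K" by simp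
  qed
  ultimately show ?thesis by (auto simp: zm_measures_def)
qed

lemma is_zm_decomposition_zm_component:
  assumes \<mu>: "\<mu> \<in> finite_signed_measures (Pi\<^sub>M J P)"
  shows "is_zm_decomposition P J \<mu> (\<lambda>H\<in>Pow J. zm_component P J \<mu> H)"
  unfolding is_zm_decomposition_def
proof (intro conjI allI impI)
  show "(\<lambda>H\<in>Pow J. zm_component P J \<mu> H) \<in> zm_families P J"
    using zm_component_zm_measures[OF \<mu>] by (auto simp: zm_families_def)
  fix A assume A: "\<forall>j\<in>J. A j \<in> sets (P j)"
  let ?a = "\<lambda>S. \<Prod>j\<in>S. measure (P j) (A j)"
  let ?m = "marginal P J \<mu> A"
  have a: "?a (J - H) * ?a (H - K) = ?a (J - K)" if "K \<subseteq> H" "H \<subseteq> J" for H K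
  proof -
    have "J - K = (J - H) \<union> (H - K)" "(J - H) \<inter> (H - K) = {}" using that by auto
    then show ?thesis
      using finite_J finite_subset_J[OF that(2)]
        prod.union_disjoint[of "J - H" "H - K" "\<lambda>j. measure (P j) (A j)"] by auto
  qed
  have "(\<Sum>H\<in>Pow J. measure (Pi\<^sub>M (J - H) P) (Pi\<^sub>E (J - H) A) *
        (\<lambda>H\<in>Pow J. zm_component P J \<mu> H) H (Pi\<^sub>E H A)) =
      (\<Sum>H\<in>Pow J. \<Sum>K | K \<in> Pow J \<and> K \<subseteq> H. (-1) ^ card (H - K) * (?a (J - K) * ?m K))"
  proof (rule sum.cong[OF refl])
    fix H assume "H \<in> Pow J"
    then have H: "H \<subseteq> J" by simp
    have "measure (Pi\<^sub>M (J - H) P) (Pi\<^sub>E (J - H) A) = ?a (J - H)"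
      using A by (intro measure_PiM_PiE) auto
    moreover have "zm_component P J \<mu> H (Pi\<^sub>E H A) =
        (\<Sum>K\<in>Pow H. (-1) ^ card (H - K) * (?a (H - K) * ?m K))"
      using A H by (intro zm_component_PiE \<mu>) auto
    moreover have "Pow H = {K. K \<in> Pow J \<and> K \<subseteq> H}" using H by auto
    moreover have scale: "?a (J - H) * ((-1) ^ card (H - K) * (?a (H - K) * ?m K)) =
        (-1) ^ card (H - K) * (?a (J - K) * ?m K)" if "K \<subseteq> H" for K
      by (simp add: a[OF that H, symmetric])
    ultimately show "measure (Pi\<^sub>M (J - H) P) (Pi\<^sub>E (J - H) A) *
        (\<lambda>H\<in>Pow J. zm_component P J \<mu> H) H (Pi\<^sub>E H A) =
        (\<Sum>K | K \<in> Pow J \<and> K \<subseteq> H. (-1) ^ card (H - K) * (?a (J - K) * ?m K))"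
      using H by (simp add: sum_distrib_left scale)
  qed
  also have "\<dots> = (\<Sum>K\<in>Pow J. \<Sum>H | H \<in> Pow J \<and> K \<subseteq> H. (-1) ^ card (H - K) * (?a (J - K) * ?m K))"
    by (rule sum.swap_restrict) (use finite_J in auto)
  also have "\<dots> = (\<Sum>K\<in>Pow J. if K = J then ?m J else 0)"
  proof (rule sum.cong[OF refl])
    fix K assume "K \<in> Pow J"
    then show "(\<Sum>H | H \<in> Pow J \<and> K \<subseteq> H. (-1) ^ card (H - K) * (?a (J - K) * ?m K)) =
        (if K = J then ?m J else 0)"
      using sum_alternating_supersets[OF finite_J, of K, where 'r = real]
      by (simp add: sum_distrib_right[symmetric])
  qed
  also have "\<dots> = ?m J" using finite_J by simp
  also have "\<dots> = \<mu> (Pi\<^sub>E J A)"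
    unfolding marginal_def by (intro arg_cong[where f = \<mu>] PiE_cong) auto
  finally show "\<mu> (Pi\<^sub>E J A) = (\<Sum>H\<in>Pow J. measure (Pi\<^sub>M (J - H) P) (Pi\<^sub>E (J - H) A) *
      (\<lambda>H\<in>Pow J. zm_component P J \<mu> H) H (Pi\<^sub>E H A))" by simp
qed


section \<open>Uniqueness, linearity and continuity\<close>

lemma marginal_decomposition:
  assumes dec: "is_zm_decomposition P J \<mu> \<nu>" and L: "L \<subseteq> J"
    and A: "\<And>j. j \<in> L \<Longrightarrow> A j \<in> sets (P j)"
  shows "marginal P J \<mu> A L =
    (\<Sum>H\<in>Pow L. (\<Prod>j\<in>L - H. measure (P j) (A j)) * \<nu> H (Pi\<^sub>E H A))"
proof -
  define B where "B j = (if j \<in> L then A j else space (P j))" for j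
  have B: "B j \<in> sets (P j)" if "j \<in> J" for j using A by (simp add: B_def)
  have "marginal P J \<mu> A L = \<mu> (Pi\<^sub>E J B)"
    by (simp add: marginal_def B_def[abs_def])
  also have "\<dots> = (\<Sum>H\<in>Pow J. measure (Pi\<^sub>M (J - H) P) (Pi\<^sub>E (J - H) B) * \<nu> H (Pi\<^sub>E H B))"
    using dec B by (simp add: is_zm_decomposition_def)
  also have "\<dots> = (\<Sum>H\<in>Pow L. (\<Prod>j\<in>L - H. measure (P j) (A j)) * \<nu> H (Pi\<^sub>E H A))"
  proof (rule sum.mono_neutral_cong_right)
    show "\<forall>H\<in>Pow J - Pow L. measure (Pi\<^sub>M (J - H) P) (Pi\<^sub>E (J - H) B) * \<nu> H (Pi\<^sub>E H B) = 0"
    proof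
      fix H assume H: "H \<in> Pow J - Pow L"
      then obtain i where "i \<in> H" "i \<notin> L" by auto
      then have "i \<in> H" "B i = space (P i)" by (simp_all add: B_def)
      moreover have "\<nu> H \<in> zm_measures P H"
        using dec H by (auto simp: is_zm_decomposition_def zm_families_def PiE_iff)
      moreover have "\<forall>j\<in>H. B j \<in> sets (P j)" using B H by auto
      ultimately have "\<nu> H (Pi\<^sub>E H B) = 0" unfolding zm_measures_def by blast
      then show "measure (Pi\<^sub>M (J - H) P) (Pi\<^sub>E (J - H) B) * \<nu> H (Pi\<^sub>E H B) = 0" by simp
    qed
  next
    fix H assume "H \<in> Pow L"
    then have H: "H \<subseteq> L" by simp
    have "measure (Pi\<^sub>M (J - H) P) (Pi\<^sub>E (J - H) B) = (\<Prod>j\<in>J - H. measure (P j) (B j))"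
      using B by (intro measure_PiM_PiE) auto
    also have "\<dots> = (\<Prod>j\<in>L - H. measure (P j) (A j))"
      using L finite_J prob_space.prob_space[OF prob_space_P]
      by (intro prod.mono_neutral_cong_right) (auto simp: B_def)
    finally have "measure (Pi\<^sub>M (J - H) P) (Pi\<^sub>E (J - H) B) = (\<Prod>j\<in>L - H. measure (P j) (A j))" .
    moreover have "Pi\<^sub>E H B = Pi\<^sub>E H A" using H by (intro PiE_cong) (auto simp: B_def)
    ultimately show "measure (Pi\<^sub>M (J - H) P) (Pi\<^sub>E (J - H) B) * \<nu> H (Pi\<^sub>E H B) =
        (\<Prod>j\<in>L - H. measure (P j) (A j)) * \<nu> H (Pi\<^sub>E H A)" by simp
  qed (use L finite_J in auto)
  finally show ?thesis .
qed

lemma zm_decomposition_unique: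
  assumes dec: "is_zm_decomposition P J \<mu> \<nu>" "is_zm_decomposition P J \<mu> \<nu>'"
  shows "\<nu> = \<nu>'"
proof -
  have fam: "\<nu> \<in> zm_families P J" "\<nu>' \<in> zm_families P J"
    using dec by (auto simp: is_zm_decomposition_def)
  have "\<nu> L = \<nu>' L" if L: "L \<subseteq> J" for L
    using finite_subset_J[OF L] L
  proof (induction L rule: finite_psubset_induct)
    case (psubset L)
    show ?case
    proof (rule finite_signed_measures_PiM_eqI[OF psubset.hyps zm_familiesD[OF fam(1) psubset.prems]
          zm_familiesD[OF fam(2) psubset.prems]])
      fix A assume A: "\<And>j. j \<in> L \<Longrightarrow> A j \<in> sets (P j)"
      have split: "(\<Sum>H\<in>Pow L. (\<Prod>j\<in>L - H. measure (P j) (A j)) * f H) =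
          f L + (\<Sum>H\<in>Pow L - {L}. (\<Prod>j\<in>L - H. measure (P j) (A j)) * f H)" for f :: "'i set \<Rightarrow> real"
        using psubset.hyps by (subst sum.remove[of _ L]) auto
      have "(\<Sum>H\<in>Pow L - {L}. (\<Prod>j\<in>L - H. measure (P j) (A j)) * \<nu> H (Pi\<^sub>E H A)) =
          (\<Sum>H\<in>Pow L - {L}. (\<Prod>j\<in>L - H. measure (P j) (A j)) * \<nu>' H (Pi\<^sub>E H A))"
      proof (rule sum.cong[OF refl])
        fix H assume "H \<in> Pow L - {L}"
        then have "H \<subset> L" by auto
        then have "\<nu> H = \<nu>' H" using psubset.prems by (intro psubset.IH) auto
        then show "(\<Prod>j\<in>L - H. measure (P j) (A j)) * \<nu> H (Pi\<^sub>E H A) =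
            (\<Prod>j\<in>L - H. measure (P j) (A j)) * \<nu>' H (Pi\<^sub>E H A)" by simp
      qed
      then show "\<nu> L (Pi\<^sub>E L A) = \<nu>' L (Pi\<^sub>E L A)"
        using marginal_decomposition[OF dec(1) psubset.prems A]
          marginal_decomposition[OF dec(2) psubset.prems A] by (simp add: split)
    qed
  qed
  then show ?thesis
    using fam unfolding zm_families_def by (intro PiE_ext) auto
qed

lemma zm_decomposition_eq:
  assumes "\<mu> \<in> finite_signed_measures (Pi\<^sub>M J P)"
  shows "zm_decomposition P J \<mu> = (\<lambda>H\<in>Pow J. zm_component P J \<mu> H)"
  unfolding zm_decomposition_def
  using is_zm_decomposition_zm_component[OF assms] zm_decomposition_unique by (intro the_equality) auto

lemma zm_component_linear:
  assumes "\<mu> \<in> finite_signed_measures (Pi\<^sub>M J P)" "\<mu>' \<in> finite_signed_measures (Pi\<^sub>M J P)" "H \<subseteq> J"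
  shows "zm_component P J (\<lambda>B. a * \<mu> B + b * \<mu>' B) H A =
    a * zm_component P J \<mu> H A + b * zm_component P J \<mu>' H A"
  unfolding zm_component_def marginal_times_def
  by (simp add: averaging.averaged_image_linear[OF averaging_mix] assms sum_distrib_left
      sum.distrib[symmetric] algebra_simps)

lemma zm_component_bound:
  assumes \<mu>: "\<mu> \<in> finite_signed_measures (Pi\<^sub>M J P)" and H: "H \<subseteq> J"
    and C: "\<And>A. A \<in> sets (Pi\<^sub>M J P) \<Longrightarrow> \<bar>\<mu> A\<bar> \<le> C"
  shows "\<bar>zm_component P J \<mu> H B\<bar> \<le> 2 ^ card J * C"
proof -
  have "0 \<le> C" using C[of "{}"] by simp
  have "\<bar>zm_component P J \<mu> H B\<bar> \<le>
      (\<Sum>K\<in>Pow H. \<bar>(-1) ^ card (H - K) * marginal_times P J H K \<mu> B\<bar>)"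
    unfolding zm_component_def by (rule sum_abs)
  also have "\<dots> \<le> (\<Sum>K\<in>Pow H. C)"
    using averaging.averaged_image_bound[OF averaging_mix[OF H] \<mu> C]
    by (intro sum_mono) (simp add: abs_mult power_abs marginal_times_def)
  also have "\<dots> = 2 ^ card H * C" by (simp add: card_Pow finite_subset_J[OF H])
  also have "\<dots> \<le> 2 ^ card J * C"
    using \<open>0 \<le> C\<close> card_mono[OF finite_J H] by (intro mult_right_mono power_increasing) auto
  finally show ?thesis .
qed

lemma family_dist_zm_decomposition:
  assumes \<mu>: "\<mu> \<in> finite_signed_measures (Pi\<^sub>M J P)" and \<mu>': "\<mu>' \<in> finite_signed_measures (Pi\<^sub>M J P)"
  shows "family_dist P J (zm_decomposition P J \<mu>) (zm_decomposition P J \<mu>') \<le>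
    2 ^ card J * sup_dist (Pi\<^sub>M J P) \<mu> \<mu>'"
proof -
  have fam: "zm_decomposition P J \<kappa> \<in> zm_families P J"
    if "\<kappa> \<in> finite_signed_measures (Pi\<^sub>M J P)" for \<kappa>
    using is_zm_decomposition_zm_component[OF that] zm_decomposition_eq[OF that]
    by (simp add: is_zm_decomposition_def)
  have "sup_dist (Pi\<^sub>M H P) (zm_decomposition P J \<mu> H) (zm_decomposition P J \<mu>' H) \<le>
      2 ^ card J * sup_dist (Pi\<^sub>M J P) \<mu> \<mu>'" if H: "H \<subseteq> J" for H
  proof (rule sup_dist_least[OF zm_familiesD[OF fam[OF \<mu>] H] zm_familiesD[OF fam[OF \<mu>'] H]])
    fix B
    \<comment> \<open>By linearity it suffices to bound the component of the difference, written as a linear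
      combination.\<close>
    have "(\<lambda>A. 1 * \<mu> A + (-1) * \<mu>' A) \<in> finite_signed_measures (Pi\<^sub>M J P)"
      by (rule finite_signed_measures_linear[OF \<mu> \<mu>'])
    then have "\<bar>zm_component P J (\<lambda>A. 1 * \<mu> A + (-1) * \<mu>' A) H B\<bar> \<le>
        2 ^ card J * sup_dist (Pi\<^sub>M J P) \<mu> \<mu>'"
      using sup_dist_upper[OF \<mu> \<mu>'] by (intro zm_component_bound H) simp_all
    then show "\<bar>zm_decomposition P J \<mu> H B - zm_decomposition P J \<mu>' H B\<bar> \<le>
        2 ^ card J * sup_dist (Pi\<^sub>M J P) \<mu> \<mu>'"
      unfolding zm_component_linear[OF \<mu> \<mu>' H]
      using H by (simp add: zm_decomposition_eq \<mu> \<mu>')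
  qed
  then show ?thesis
    unfolding family_dist_eq[OF fam[OF \<mu>] fam[OF \<mu>']]
    using finite_J by (intro Max.boundedI) auto
qed

lemma continuous_map_zm_decomposition:
  "continuous_map (signed_measure_topology (Pi\<^sub>M J P)) (zm_family_topology P J)
    (zm_decomposition P J)"
  unfolding signed_measure_topology_def zm_family_topology_def
    Metric_space.metric_continuous_map[OF Metric_space_sup_dist Metric_space_family_dist[OF finite_J]]
proof (intro conjI ballI allI impI)
  show "zm_decomposition P J ` finite_signed_measures (Pi\<^sub>M J P) \<subseteq> zm_families P J"
    using is_zm_decomposition_zm_component by (auto simp: zm_decomposition_eq is_zm_decomposition_def)
  fix \<mu> and \<epsilon> :: real
  assume \<mu>: "\<mu> \<in> finite_signed_measures (Pi\<^sub>M J P)" and \<epsilon>: "0 < \<epsilon>"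
  show "\<exists>\<delta>>0. \<forall>\<mu>'. \<mu>' \<in> finite_signed_measures (Pi\<^sub>M J P) \<and> sup_dist (Pi\<^sub>M J P) \<mu> \<mu>' < \<delta> \<longrightarrow>
      family_dist P J (zm_decomposition P J \<mu>) (zm_decomposition P J \<mu>') < \<epsilon>"
  proof (intro exI[of _ "\<epsilon> / 2 ^ card J"] conjI allI impI)
    fix \<mu>'
    assume "\<mu>' \<in> finite_signed_measures (Pi\<^sub>M J P) \<and> sup_dist (Pi\<^sub>M J P) \<mu> \<mu>' < \<epsilon> / 2 ^ card J"
    then have \<mu>': "\<mu>' \<in> finite_signed_measures (Pi\<^sub>M J P)"
      and "2 ^ card J * sup_dist (Pi\<^sub>M J P) \<mu> \<mu>' < \<epsilon>"
      by (auto simp: field_simps)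
    with family_dist_zm_decomposition[OF \<mu> \<mu>']
    show "family_dist P J (zm_decomposition P J \<mu>) (zm_decomposition P J \<mu>') < \<epsilon>" by linarith
  qed (use \<epsilon> in simp)
qed

end

theorem theorem1:
  fixes p :: nat and P :: "nat \<Rightarrow> 'a measure" and J :: "nat set"
  assumes "p \<ge> 1" and J: "J = {1..p}" and "\<And>j. j \<in> J \<Longrightarrow> prob_space (P j)"
  shows "(\<forall>\<mu> \<in> finite_signed_measures (Pi\<^sub>M J P). \<exists>!\<nu>. is_zm_decomposition P J \<mu> \<nu>) \<and>
    (\<forall>\<mu> \<in> finite_signed_measures (Pi\<^sub>M J P). \<forall>\<mu>' \<in> finite_signed_measures (Pi\<^sub>M J P). \<forall>a b :: real.
       \<forall>H \<subseteq> J. \<forall>A. zm_decomposition P J (\<lambda>B. a * \<mu> B + b * \<mu>' B) H A =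
         a * zm_decomposition P J \<mu> H A + b * zm_decomposition P J \<mu>' H A) \<and>
    continuous_map (signed_measure_topology (Pi\<^sub>M J P)) (zm_family_topology P J)
      (zm_decomposition P J)"
proof -
  have "finite J" using J by simp
  then interpret finite_prob_family P J
    using assms(3) by (rule finite_prob_family.intro)
  show ?thesis
  proof (intro conjI ballI allI impI)
    fix \<mu> assume "\<mu> \<in> finite_signed_measures (Pi\<^sub>M J P)"
    then show "\<exists>!\<nu>. is_zm_decomposition P J \<mu> \<nu>"
      using is_zm_decomposition_zm_component zm_decomposition_unique by blast
  next
    fix \<mu> \<mu>' a b H A
    assume "\<mu> \<in> finite_signed_measures (Pi\<^sub>M J P)" "\<mu>' \<in> finite_signed_measures (Pi\<^sub>M J P)" "H \<subseteq> J"
    then show "zm_decomposition P J (\<lambda>B. a * \<mu> B + b * \<mu>' B) H A =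
        a * zm_decomposition P J \<mu> H A + b * zm_decomposition P J \<mu>' H A"
      by (simp add: zm_decomposition_eq finite_signed_measures_linear zm_component_linear)
  qed (rule continuous_map_zm_decomposition)
qed

end
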